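(* Let $n, m \ge 1$ be integers and let $P(\lambda)=I\lambda^m+A_{m-1}\lambda^{m-1}+\cdots+A_0$ be an $n \times n$ monic matrix polynomial, where $A_l \in M_n(\mathbb{C})$ for $0\le l\le m-1$ and $I$ is the $n\times n$ identity matrix. Let $S(\lambda)= \sum_{i=1}^{n}p_{ii}(\lambda)$, where $p_{ii}(\lambda)$ denotes the $i$th diagonal entry of $P(\lambda)$. If $\lambda_1,\ldots,\lambda_{mn}$ are the eigenvalues of $P(\lambda)$, counted with algebraic multiplicity, then $$\sum_{k=1}^{mn}\lambda_k = n\cdot\left(\text{sum of the roots of }S(\lambda)\right),$$ where the roots of $S(\lambda)$ are counted with multiplicity.
   Context: $M_n(\mathbb{C})$ is the set of $n\times n$ complex matrices. A matrix polynomial $P(\lambda)=\sum_{l=0}^m A_l\lambda^l$ with $A_l=[a_l^{(ij)}]\in M_n(\mathbb{C})$ is viewed as an $n\times n$ matrix $[p_{ij}(\lambda)]$ of scalar polynomials $p_{ij}(\lambda)=\sum_{l=0}^m a_l^{(ij)}\lambda^l$. When the leading coefficient is nonsingular (in particular when it is $I$), the eigenvalues of $P(\lambda)$ are the complex numbers $\lambda_0$ with $\det P(\lambda_0)=0$; the algebraic multiplicity of an eigenvalue is its multiplicity as a root of the scalar polynomial $\det P(\lambda)$, and there are exactly $mn$ eigenvalues counted with algebraic multiplicity. *)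

theory Defs
  imports
    "Jordan_Normal_Form.Determinant"
    "HOL-Computational_Algebra.Computational_Algebra"
    Complex_Main
begin

text \<open>
  A matrix polynomial \<open>A\<^sub>0 + A\<^sub>1 \<lambda> + \<dots> + A\<^sub>m \<lambda>\<^sup>m\<close> with \<open>n \<times> n\<close> coefficients, viewed as
  the matrix of its scalar entry polynomials. Rows and columns are indexed by \<open>0, \<dots>, n - 1\<close>.
\<close>

definition matrix_poly :: "nat \<Rightarrow> nat \<Rightarrow> (nat \<Rightarrow> complex mat) \<Rightarrow> complex poly mat" where
  "matrix_poly n m A = mat n n (\<lambda>(i, j). \<Sum>l\<le>m. Polynomial.monom (A l $$ (i, j)) l)"

definition eval_matrix_poly :: "complex poly mat \<Rightarrow> complex \<Rightarrow> complex mat" where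
  "eval_matrix_poly P z = map_mat (\<lambda>p. poly p z) P"

text \<open>
  The next three notions are intended for matrix polynomials with nonsingular leading coefficient,
  so that \<open>det P\<close> is a nonzero polynomial (\<open>Polynomial.order z 0\<close> has no meaningful value).
\<close>

definition mp_eigenvalue :: "complex poly mat \<Rightarrow> complex \<Rightarrow> bool" where
  "mp_eigenvalue P z \<longleftrightarrow> det (eval_matrix_poly P z) = 0"

definition mp_alg_mult :: "complex poly mat \<Rightarrow> complex \<Rightarrow> nat" where
  "mp_alg_mult P z = Polynomial.order z (det P)"

definition lists_mp_eigenvalues ::
    "complex poly mat \<Rightarrow> nat \<Rightarrow> (nat \<Rightarrow> complex) \<Rightarrow> bool" where
  "lists_mp_eigenvalues P N \<mu> \<longleftrightarrow>
     (\<forall>k\<in>{1..N}. mp_eigenvalue P (\<mu> k)) \<and>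
     (\<forall>z. mp_eigenvalue P z \<longrightarrow> card {k \<in> {1..N}. \<mu> k = z} = mp_alg_mult P z)"

end

(* In the Leibniz expansion of det P, a non-identity permutation meets at least two off-diagonal
   entries, each of degree < m, so it contributes only in degrees <= mn - 2. Hence det P agrees with
   the product of the diagonal entries in its two top coefficients. By Vieta the eigenvalues have the
   same sum as the roots of all the p_ii together, which is -tr A_(m-1); the roots of S, with leading
   coefficients n and tr A_(m-1), sum to -tr A_(m-1) / n. *)
theory Submission
  imports Defs
begin

text \<open>Vieta's formulas for the two top coefficients, by induction on the multiset: multiplying
  by \<open>[:-x, 1:]\<close> shifts the coefficients up by one and subtracts \<open>x\<close> times
  the old ones.\<close>

lemma coeff_prod_mset_linear:
  fixes M :: "'a::comm_ring_1 multiset"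
  shows "Polynomial.coeff (\<Prod>x\<in>#M. [:-x, 1:]) (size M) = 1"
    and "size M = Suc k \<Longrightarrow> Polynomial.coeff (\<Prod>x\<in>#M. [:-x, 1:]) k = - (\<Sum>x\<in>#M. x)"
proof -
  have le: "Polynomial.degree (\<Prod>x\<in>#M. [:-x, 1:]) \<le> size M" for M :: "'a multiset"
  proof (induction M)
    case (add x M)
    have "Polynomial.degree ([:-x, 1:] * (\<Prod>x\<in>#M. [:-x, 1:])) \<le>
        Polynomial.degree [:-x, 1:] + Polynomial.degree (\<Prod>x\<in>#M. [:-x, 1:])"
      by (rule degree_mult_le)
    also have "\<dots> \<le> 1 + size M"
      using add by (intro add_mono) auto
    finally show ?case by simp
  qed simp
  have top: "Polynomial.coeff (\<Prod>x\<in>#M. [:-x, 1:]) (size M) = 1" for M :: "'a multiset"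
  proof (induction M)
    case (add x M)
    \<comment> \<open>The new top coefficient is the old one at \<open>size M\<close> minus
      \<open>x\<close> times this vanishing one.\<close>
    have "Polynomial.coeff (\<Prod>x\<in>#M. [:-x, 1:]) (Suc (size M)) = 0"
      using le[of M] by (intro coeff_eq_0) auto
    with add show ?case by simp
  qed simp
  show "Polynomial.coeff (\<Prod>x\<in>#M. [:-x, 1:]) (size M) = 1" by (rule top)
  show "size M = Suc k \<Longrightarrow> Polynomial.coeff (\<Prod>x\<in>#M. [:-x, 1:]) k = - (\<Sum>x\<in>#M. x)"
  proof (induction M arbitrary: k)
    case (add x M)
    then have k: "k = size M" by simp
    show ?case
    proof (cases k)
      case 0
      with k show ?thesis by simp
    next
      \<comment> \<open>The coefficient at \<open>Suc j\<close> is that of the smaller product at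
        \<open>j\<close>, given by induction, minus \<open>x\<close> times its top coefficient
        1.\<close>
      case (Suc j)
      with k have "size M = Suc j" by simp
      with Suc add.IH[of j] top[of M] show ?thesis by simp
    qed
  qed simp
qed

text \<open>Vieta after splitting into linear factors over the complex numbers. Keeping the leading
  coefficient as a factor makes the formula fit both the monic determinant and \<open>S\<close>,
  whose leading coefficient is \<open>n\<close>.\<close>

lemma lead_coeff_mult_sum_proots:
  fixes p :: "complex poly"
  assumes "Polynomial.degree p = Suc k"
  shows "lead_coeff p * (\<Sum>z\<in>#proots p. z) = - Polynomial.coeff p k"
proof -
  have "size (proots p) = Suc k"
    using assms by (simp add: size_proots_complex)
  from coeff_prod_mset_linear(2)[OF this]
  have "Polynomial.coeff (smult (lead_coeff p) (\<Prod>x\<in>#proots p. [:-x, 1:])) k =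
      - (lead_coeff p * (\<Sum>z\<in>#proots p. z))"
    by simp
  then show ?thesis
    by (simp only: complex_poly_decompose_multiset) simp
qed

text \<open>If \<open>i\<close> is moved then so is \<open>p i\<close>, since \<open>p\<close> is
  injective, and the two points are distinct.\<close>

lemma two_moved_points:
  assumes "p permutes S" "p \<noteq> id" "finite S"
  shows "2 \<le> card {i \<in> S. p i \<noteq> i}"
proof -
  obtain i where i: "p i \<noteq> i"
    using assms(2) by fastforce
  have "p (p i) \<noteq> p i"
    using i permutes_inj[OF assms(1)] by (auto dest: injD)
  moreover have "i \<in> S" "p i \<in> S"
    using i assms(1) by (metis permutes_not_in permutes_in_image)+
  ultimately have "{i, p i} \<subseteq> {i \<in> S. p i \<noteq> i}"
    using i by auto
  from card_mono[OF _ this] show ?thesis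
    using i assms(3) by auto
qed

text \<open>Each moved point costs a Leibniz term at least one degree out of \<open>m * n\<close>.
  The condition on \<open>k\<close> selects the degrees from \<open>m * n - 1\<close> upwards, which
  a term that has lost two degrees cannot reach.\<close>

lemma coeff_det_eq_coeff_prod_diag:
  fixes A :: "'a::idom poly mat"
  assumes A: "A \<in> carrier_mat n n"
    and diag: "\<And>i. i < n \<Longrightarrow> Polynomial.degree (A $$ (i, i)) \<le> m"
    and off: "\<And>i j. i < n \<Longrightarrow> j < n \<Longrightarrow> i \<noteq> j \<Longrightarrow> Polynomial.degree (A $$ (i, j)) < m"
    and k: "m * n \<le> Suc k"
  shows "Polynomial.coeff (det A) k = Polynomial.coeff (\<Prod>i<n. A $$ (i, i)) k"
proof -
  let ?U = "{0..<n}"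
  let ?t = "\<lambda>p. signof p * (\<Prod>i\<in>?U. A $$ (i, p i))"
  have zero: "Polynomial.coeff (?t p) k = 0" if p: "p permutes ?U" "p \<noteq> id" for p
  proof -
    \<comment> \<open>Adding 1 for every moved row compensates for the strict off-diagonal bound, so
      that each row contributes at most \<open>m\<close>.\<close>
    have "Polynomial.degree (\<Prod>i\<in>?U. A $$ (i, p i)) + card {i \<in> ?U. p i \<noteq> i} \<le>
        (\<Sum>i\<in>?U. Polynomial.degree (A $$ (i, p i))) + (\<Sum>i\<in>?U. of_bool (p i \<noteq> i))"
    proof (rule add_mono)
      show "Polynomial.degree (\<Prod>i\<in>?U. A $$ (i, p i)) \<le>
          (\<Sum>i\<in>?U. Polynomial.degree (A $$ (i, p i)))"
        using degree_prod_sum_le[of ?U "\<lambda>i. A $$ (i, p i)"] by (simp add: o_def)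
      show "card {i \<in> ?U. p i \<noteq> i} \<le> (\<Sum>i\<in>?U. of_bool (p i \<noteq> i))"
        by (simp add: sum_of_bool_eq Int_def)
    qed
    also have "\<dots> = (\<Sum>i\<in>?U. Polynomial.degree (A $$ (i, p i)) + of_bool (p i \<noteq> i))"
      by (simp only: sum.distrib)
    also have "\<dots> \<le> (\<Sum>i\<in>?U. m)"
    proof (rule sum_mono)
      fix i assume i: "i \<in> ?U"
      then have "p i < n" using permutes_in_image[OF p(1), of i] by simp
      with i diag[of i] off[of i "p i"]
      show "Polynomial.degree (A $$ (i, p i)) + of_bool (p i \<noteq> i) \<le> m"
        by (cases "p i = i") auto
    qed
    finally have "Polynomial.degree (\<Prod>i\<in>?U. A $$ (i, p i)) < k"
      using two_moved_points[OF p] k by (simp add: mult.commute)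
    then have "Polynomial.coeff (\<Prod>i\<in>?U. A $$ (i, p i)) k = 0"
      by (rule coeff_eq_0)
    then show ?thesis by (simp add: sign_def)
  qed
  have "Polynomial.coeff (det A) k = (\<Sum>p | p permutes ?U. Polynomial.coeff (?t p) k)"
    by (simp add: det_def'[OF A] coeff_sum)
  also have "\<dots> = (\<Sum>p\<in>{id}. Polynomial.coeff (?t p) k)"
    using zero by (intro sum.mono_neutral_right) (auto simp: finite_permutations)
  finally show ?thesis
    by (simp add: sign_def atLeast0LessThan)
qed

lemma sum_proots_det:
  fixes P :: "complex poly mat"
  assumes P: "P \<in> carrier_mat n n" and "n \<ge> 1" "m \<ge> 1"
    and diag: "\<And>i. i < n \<Longrightarrow> Polynomial.degree (P $$ (i, i)) = m \<and> lead_coeff (P $$ (i, i)) = 1"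
    and off: "\<And>i j. i < n \<Longrightarrow> j < n \<Longrightarrow> i \<noteq> j \<Longrightarrow> Polynomial.degree (P $$ (i, j)) < m"
  shows "det P \<noteq> 0"
    and "(\<Sum>z\<in>#proots (det P). z) = - (\<Sum>i<n. Polynomial.coeff (P $$ (i, i)) (m - 1))"
proof -
  define D where "D = (\<Prod>i<n. P $$ (i, i))"
  obtain k where k: "m * n = Suc k"
    using assms(2,3) by (metis Suc_le_D mult_eq_0_iff not0_implies_Suc not_one_le_zero)
  have nz: "P $$ (i, i) \<noteq> 0" if "i < n" for i
    using diag[OF that] by auto
  \<comment> \<open>Agreement at every index from \<open>k\<close> on, not only at the top two, also
    transfers the degree of \<open>D\<close> to \<open>det P\<close>.\<close>
  have same: "Polynomial.coeff (det P) j = Polynomial.coeff D j" if "k \<le> j" for j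
    unfolding D_def using that k diag
    by (intro coeff_det_eq_coeff_prod_diag[OF P _ off]) auto
  have deg_D: "Polynomial.degree D = Suc k"
    unfolding D_def using nz diag k by (subst degree_prod_eq_sum_degree) (auto simp: mult.commute)
  have lead_D: "lead_coeff D = 1"
    unfolding D_def lead_coeff_prod using diag by (intro prod.neutral) auto
  have deg_det: "Polynomial.degree (det P) = Suc k"
  proof (rule antisym)
    show "Polynomial.degree (det P) \<le> Suc k"
      using deg_D by (intro degree_le) (auto simp: same coeff_eq_0)
    show "Suc k \<le> Polynomial.degree (det P)"
      using deg_D lead_D same[of "Suc k"] by (intro le_degree) auto
  qed
  then show "det P \<noteq> 0" by auto
  have lead_det: "lead_coeff (det P) = 1"
    using deg_det deg_D lead_D same[of "Suc k"] by simp
  have "(\<Sum>z\<in>#proots (det P). z) = (\<Sum>z\<in>#proots D. z)"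
    using lead_coeff_mult_sum_proots[OF deg_det] lead_coeff_mult_sum_proots[OF deg_D]
      lead_det lead_D same[of k] by simp
  \<comment> \<open>Splitting the roots of \<open>D\<close> among the diagonal entries and applying
    Vieta to each entry replaces an expansion of the second coefficient of a product.\<close>
  also have "\<dots> = (\<Sum>i<n. \<Sum>z\<in>#proots (P $$ (i, i)). z)"
  proof -
    have "(\<Sum>z\<in>#(\<Sum>i\<in>I. f i). z) = (\<Sum>i\<in>I. \<Sum>z\<in>#f i. z)"
      for I :: "nat set" and f :: "nat \<Rightarrow> complex multiset"
      by (induction I rule: infinite_finite_induct) auto
    then show ?thesis
      unfolding D_def using nz by (subst proots_prod) auto
  qed
  also have "\<dots> = (\<Sum>i<n. - Polynomial.coeff (P $$ (i, i)) (m - 1))"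
  proof (rule sum.cong)
    fix i assume "i \<in> {..<n}"
    then have "lead_coeff (P $$ (i, i)) = 1" "Polynomial.degree (P $$ (i, i)) = Suc (m - 1)"
      using diag[of i] \<open>m \<ge> 1\<close> by auto
    then show "(\<Sum>z\<in>#proots (P $$ (i, i)). z) = - Polynomial.coeff (P $$ (i, i)) (m - 1)"
      using lead_coeff_mult_sum_proots by fastforce
  qed simp
  finally show "(\<Sum>z\<in>#proots (det P). z) = - (\<Sum>i<n. Polynomial.coeff (P $$ (i, i)) (m - 1))"
    by (simp add: sum_negf)
qed

text \<open>Evaluation at \<open>z\<close> is a ring homomorphism, hence commutes with the
  determinant.\<close>

lemma mp_eigenvalue_iff_root: "mp_eigenvalue P z \<longleftrightarrow> poly (det P) z = 0"
proof -
  interpret comm_ring_hom "\<lambda>p. poly p z"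
    by unfold_locales auto
  show ?thesis
    by (simp add: mp_eigenvalue_def eval_matrix_poly_def)
qed

text \<open>The listing and the roots of \<open>det P\<close> have the same count at every
  \<open>z\<close>, so sums over them coincide.\<close>

lemma image_mset_lists_mp_eigenvalues:
  assumes "lists_mp_eigenvalues P N \<mu>" "det P \<noteq> 0"
  shows "image_mset \<mu> (mset_set {1..N}) = proots (det P)"
proof (rule multiset_eqI)
  fix z
  have "count (image_mset \<mu> (mset_set {1..N})) z = card {k \<in> {1..N}. \<mu> k = z}"
    by (auto simp: count_image_mset' intro!: arg_cong[where f = card])
  also have "\<dots> = Polynomial.order z (det P)"
  proof (cases "mp_eigenvalue P z")
    case True
    with assms(1) show ?thesis
      by (simp add: lists_mp_eigenvalues_def mp_alg_mult_def)
  next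
    \<comment> \<open>A non-eigenvalue is never listed, and its order as a root is 0.\<close>
    case False
    with assms(1) have "{k \<in> {1..N}. \<mu> k = z} = {}"
      by (auto simp: lists_mp_eigenvalues_def)
    with False show ?thesis
      by (simp only: mp_eigenvalue_iff_root) (simp add: order_0I)
  qed
  finally show "count (image_mset \<mu> (mset_set {1..N})) z = count (proots (det P)) z"
    using assms(2) by simp
qed

lemma coeff_matrix_poly:
  assumes "i < n" "j < n"
  shows "Polynomial.coeff (matrix_poly n m A $$ (i, j)) l = (if l \<le> m then A l $$ (i, j) else 0)"
  using assms by (simp add: matrix_poly_def coeff_sum)

theorem corollary3p2:
  fixes n m :: nat
    and A :: "nat \<Rightarrow> complex mat"
    and P :: "complex poly mat"
    and S :: "complex poly"
    and \<mu> :: "nat \<Rightarrow> complex"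
  assumes "n \<ge> 1" and "m \<ge> 1"
    and "\<And>l. l < m \<Longrightarrow> A l \<in> carrier_mat n n"
    and "A m = 1\<^sub>m n"
    and "P = matrix_poly n m A"
    and "S = (\<Sum>i<n. P $$ (i, i))"
    and "lists_mp_eigenvalues P (m * n) \<mu>"
  shows "(\<Sum>k = 1..m * n. \<mu> k) = of_nat n * (\<Sum>z\<in>#proots S. z)"
proof -
  have P: "P \<in> carrier_mat n n"
    by (simp add: assms(5) matrix_poly_def)
  have c: "Polynomial.coeff (P $$ (i, j)) l = (if l \<le> m then A l $$ (i, j) else 0)"
    if "i < n" "j < n" for i j l
    using that by (simp add: assms(5) coeff_matrix_poly)
  have deg: "Polynomial.degree (P $$ (i, i)) = m" if "i < n" for i
    using that assms(4) by (intro antisym degree_le le_degree) (auto simp: c)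
  have diag: "Polynomial.degree (P $$ (i, i)) = m \<and> lead_coeff (P $$ (i, i)) = 1" if "i < n" for i
    using that assms(4) by (auto simp: deg c)
  \<comment> \<open>The coefficient at \<open>m\<close> is an off-diagonal entry of the identity;
    \<open>m \<ge> 1\<close> makes the strict bound hold even for a zero entry.\<close>
  have off: "Polynomial.degree (P $$ (i, j)) < m" if "i < n" "j < n" "i \<noteq> j" for i j
    using that assms(2,4) by (intro degree_lessI) (auto simp: c)
  \<comment> \<open>The \<open>n\<close> monic entries add up to \<open>n\<close>, nonzero in the
    complex numbers, so \<open>S\<close> keeps degree \<open>m\<close>.\<close>
  have "Polynomial.coeff S m = of_nat n"
    using diag deg by (simp add: assms(6) coeff_sum c assms(4))
  moreover have "Polynomial.degree S \<le> m"
    unfolding assms(6) using deg by (intro degree_sum_le) auto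
  ultimately have deg_S: "Polynomial.degree S = Suc (m - 1)" and lead_S: "lead_coeff S = of_nat n"
    using assms(1,2) le_degree[of S m] by auto
  have "(\<Sum>k = 1..m * n. \<mu> k) = (\<Sum>z\<in>#image_mset \<mu> (mset_set {1..m * n}). z)"
    by (simp add: sum_unfold_sum_mset)
  also have "\<dots> = (\<Sum>z\<in>#proots (det P). z)"
    using image_mset_lists_mp_eigenvalues[OF assms(7)] sum_proots_det(1)[OF P assms(1,2) diag off]
    by simp
  also have "\<dots> = - Polynomial.coeff S (m - 1)"
    using sum_proots_det(2)[OF P assms(1,2) diag off] by (simp add: assms(6) coeff_sum)
  also have "\<dots> = of_nat n * (\<Sum>z\<in>#proots S. z)"
    using lead_coeff_mult_sum_proots[OF deg_S] lead_S by simp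
  finally show ?thesis .
qed

end
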